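(* Let $X$ be a locally convex space such that $\mathcal{D}(\mathbb{R})\hookrightarrow X \hookrightarrow C^{\infty}(\mathbb{R})$ with continuous inclusions, and let $\varphi\in C^{\infty}(\mathbb{R})$ be a non constant function with the property that $f\circ\varphi\in X$ for each $f\in X$. Then $C_{\varphi}:X\to X$, $f\mapsto f\circ\varphi$, is not compact. In particular, $C_{\varphi}: S(\mathbb{R})\to S(\mathbb{R})$ is not compact for any symbol $\varphi$ for $S(\mathbb{R})$.
   Context: All functions are real-valued. $C^{\infty}(\mathbb{R})$ is the Fréchet space of smooth functions $\mathbb{R}\to\mathbb{R}$ with the topology of uniform convergence of all derivatives on compact sets, and $\mathcal{D}(\mathbb{R})$ is the space of compactly supported smooth functions with its usual (inductive limit) topology. $S(\mathbb{R})$ is the (real) Schwartz space of smooth functions $f:\mathbb{R}\to\mathbb{R}$ such that $\pi_n(f):=\sup_{x\in \mathbb{R}}\sup_{0\leq j\leq n}(1+|x|^2)^n|f^{(j)}(x)|<\infty$ for each $n\in\mathbb{N}$, endowed with the Fréchet topology generated by $(\pi_n)_{n}$. A function $\varphi\in C^\infty(\mathbb{R})$ is called a symbol for $S(\mathbb{R})$ if $f\circ\varphi\in S(\mathbb{R})$ whenever $f\in S(\mathbb{R})$. An operator $T:E\to F$ between locally convex spaces is compact if there is a $0$-neighbourhood $U$ in $E$ such that $T(U)$ is a relatively compact subset of $F$. *)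

theory Defs
  imports "HOL-Analysis.Analysis" "HOL-Library.Function_Algebras"
begin

text \<open>
  With scalar multiplication added to the pointwise operations of \<^theory>\<open>HOL-Library.Function_Algebras\<close>,
  the library's notions for \<^class>\<open>real_vector\<close> (subspaces, convex sets) apply to function spaces.
\<close>

instantiation "fun" :: (type, real_vector) real_vector
begin

definition scaleR_fun :: "real \<Rightarrow> ('a \<Rightarrow> 'b) \<Rightarrow> 'a \<Rightarrow> 'b"
  where "scaleR_fun c f = (\<lambda>x. c *\<^sub>R f x)"

instance
  by standard (simp_all add: scaleR_fun_def fun_eq_iff scaleR_add_right scaleR_add_left)

end

subsection \<open>Locally convex spaces and compact operators\<close>

text \<open>
  A locally convex space is represented by its topology, whose \<^const>\<open>topspace\<close> is a linear subspace of
  an ambient vector space. The Hausdorff property is not part of the definition; a space that embeds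
  continuously into a Hausdorff space is automatically Hausdorff.
\<close>

definition locally_convex_space :: "'a::real_vector topology \<Rightarrow> bool"
  where "locally_convex_space T \<longleftrightarrow>
    subspace (topspace T) \<and>
    continuous_map (prod_topology T T) T (\<lambda>(x, y). x + y) \<and>
    continuous_map (prod_topology euclideanreal T) T (\<lambda>(c, x). c *\<^sub>R x) \<and>
    (\<forall>U. openin T U \<and> 0 \<in> U \<longrightarrow> (\<exists>V. openin T V \<and> 0 \<in> V \<and> convex V \<and> V \<subseteq> U))"

definition zero_neighbourhood :: "'a::zero topology \<Rightarrow> 'a set \<Rightarrow> bool"
  where "zero_neighbourhood T U \<longleftrightarrow>
    U \<subseteq> topspace T \<and> (\<exists>V. openin T V \<and> 0 \<in> V \<and> V \<subseteq> U)"

definition compact_operator ::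
    "'a::real_vector topology \<Rightarrow> 'b::real_vector topology \<Rightarrow> ('a \<Rightarrow> 'b) \<Rightarrow> bool"
  where "compact_operator E F A \<longleftrightarrow>
    (\<exists>U. zero_neighbourhood E U \<and> compactin F (F closure_of (A ` U)))"

text \<open>
  \<open>E \<hookrightarrow> F\<close>: the underlying set of \<open>E\<close> is contained in that of \<open>F\<close> and the inclusion is continuous
  (both are part of \<^const>\<open>continuous_map\<close>).
\<close>

definition continuously_included :: "'a topology \<Rightarrow> 'a topology \<Rightarrow> bool"
  where "continuously_included E F \<longleftrightarrow> continuous_map E F (\<lambda>x. x)"

text \<open>The topology on the subspace \<open>E\<close> generated by a (nonempty) family \<open>P\<close> of seminorms on \<open>E\<close>.\<close>

definition seminorm_topology :: "'a::real_vector set \<Rightarrow> ('a \<Rightarrow> real) set \<Rightarrow> 'a topology"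
  where "seminorm_topology E P =
    topology_generated_by {{y \<in> E. p (y - x) < \<epsilon>} | p x \<epsilon>. p \<in> P \<and> x \<in> E \<and> \<epsilon> > 0}"

subsection \<open>Smooth functions\<close>

definition smooth :: "(real \<Rightarrow> real) \<Rightarrow> bool"
  where "smooth f \<longleftrightarrow> (\<forall>n x. (deriv ^^ n) f differentiable (at x))"

text \<open>\<open>K\<close> has to be nonempty, since the supremum of the empty set of reals is an arbitrary number.\<close>

definition Cinf_topology :: "(real \<Rightarrow> real) topology"
  where "Cinf_topology = seminorm_topology {f. smooth f}
    {\<lambda>f. SUP x\<in>K. \<bar>(deriv ^^ j) f x\<bar> | K j. compact K \<and> K \<noteq> {}}"

subsection \<open>Test functions\<close>

definition test_functions :: "(real \<Rightarrow> real) set"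
  where "test_functions = {f. smooth f \<and> compact (closure {x. f x \<noteq> 0})}"

definition test_functions_on :: "real set \<Rightarrow> (real \<Rightarrow> real) set"
  where "test_functions_on K = {f. smooth f \<and> closure {x. f x \<noteq> 0} \<subseteq> K}"

text \<open>
  The locally convex inductive limit topology: the supremum (and hence the finest) of all locally
  convex topologies on the space of test functions for which the inclusions of the spaces of test
  functions supported in a fixed compact set are continuous.
\<close>

definition test_function_topology :: "(real \<Rightarrow> real) topology"
  where "test_function_topology = topology_generated_by
    {U. \<exists>\<tau>. locally_convex_space \<tau> \<and> topspace \<tau> = test_functions \<and>
          (\<forall>K. compact K \<longrightarrow>
             continuously_included (subtopology Cinf_topology (test_functions_on K)) \<tau>) \<and>
          openin \<tau> U}"

subsection \<open>The Schwartz space\<close>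

definition schwartz_weight :: "nat \<Rightarrow> (real \<Rightarrow> real) \<Rightarrow> real \<Rightarrow> real"
  where "schwartz_weight n f x = (SUP j\<in>{0..n}. (1 + \<bar>x\<bar>\<^sup>2) ^ n * \<bar>(deriv ^^ j) f x\<bar>)"

definition schwartz_seminorm :: "nat \<Rightarrow> (real \<Rightarrow> real) \<Rightarrow> real"
  where "schwartz_seminorm n f = (SUP x. schwartz_weight n f x)"

text \<open>Boundedness expresses that the supremum defining \<^const>\<open>schwartz_seminorm\<close> is finite.\<close>

definition schwartz_space :: "(real \<Rightarrow> real) set"
  where "schwartz_space = {f. smooth f \<and> (\<forall>n. bdd_above (range (schwartz_weight n f)))}"

definition schwartz_topology :: "(real \<Rightarrow> real) topology"
  where "schwartz_topology = seminorm_topology schwartz_space (range schwartz_seminorm)"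

definition schwartz_symbol :: "(real \<Rightarrow> real) \<Rightarrow> bool"
  where "schwartz_symbol \<phi> \<longleftrightarrow> smooth \<phi> \<and> (\<forall>f \<in> schwartz_space. f \<circ> \<phi> \<in> schwartz_space)"

end

theory Submission
  imports Defs
begin

text \<open>
  Both in an intermediate space \<open>X\<close> and in the Schwartz space, a neighbourhood of \<open>0\<close> contains all
  test functions with support in a fixed compact set that are small in some \<open>C\<^sup>m\<close> norm, whereas on a
  compact set of functions every derivative is uniformly bounded on bounded intervals. Choose \<open>x0\<close>
  with \<open>\<phi>'(x0) \<noteq> 0\<close>, let \<open>y0 = \<phi> x0\<close>, and test with \<open>f y = \<eta> t\<^sup>m bump ((y - y0) / t)\<close> for
  small \<open>t > 0\<close>; these functions are uniformly small in \<open>C\<^sup>m\<close>. Since \<open>f \<circ> \<phi>\<close> vanishes around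
  \<open>x0 + r t\<close> for a suitable constant \<open>r\<close>, Taylor's formula at this point and a uniform bound on the
  derivative of order \<open>m + 1\<close> would give \<open>f y0 = O(t ^ (m + 1))\<close>, but \<open>f y0 = \<eta> t\<^sup>m bump 0\<close>.
  The Taylor argument avoids computing higher derivatives of \<open>f \<circ> \<phi>\<close>.
\<close>

subsection \<open>Iterated derivatives\<close>

lemma smooth_iterated_DERIV:
  assumes "smooth f"
  shows "((deriv ^^ n) f has_real_derivative (deriv ^^ Suc n) f x) (at x)"
  using assms by (simp add: smooth_def DERIV_deriv_iff_real_differentiable)

lemma smooth_iterated_continuous_on:
  assumes "smooth f"
  shows "continuous_on S ((deriv ^^ n) f)"
  using smooth_iterated_DERIV[OF assms]
  by (meson DERIV_isCont continuous_at_imp_continuous_on)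

lemma smooth_imp_DERIV:
  assumes "smooth f"
  shows "(f has_real_derivative deriv f x) (at x)"
  using smooth_iterated_DERIV[OF assms, of 0] by simp

text \<open>Functions of this affine form are closed under differentiation up to constants, so one
  induction serves negation as well as translated and rescaled bumps.\<close>

lemma iterated_deriv_affine:
  assumes "smooth f"
  shows "(deriv ^^ n) (\<lambda>x. c * f (a * x + b)) = (\<lambda>x. c * a ^ n * (deriv ^^ n) f (a * x + b))"
proof (induction n)
  case (Suc n)
  have "((\<lambda>x. c * a ^ n * (deriv ^^ n) f (a * x + b)) has_real_derivative
          c * a ^ Suc n * (deriv ^^ Suc n) f (a * x + b)) (at x)" for x
    by (rule derivative_eq_intros DERIV_chain2[OF smooth_iterated_DERIV[OF assms]] refl)+ simp
  then show ?case
    using Suc by (auto intro!: DERIV_imp_deriv)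
qed simp

lemma smooth_affine:
  assumes "smooth f"
  shows "smooth (\<lambda>x. c * f (a * x + b))"
  unfolding smooth_def iterated_deriv_affine[OF assms]
proof (intro allI)
  fix n x
  have "((\<lambda>x. c * a ^ n * (deriv ^^ n) f (a * x + b)) has_real_derivative
          c * a ^ Suc n * (deriv ^^ Suc n) f (a * x + b)) (at x)"
    by (rule derivative_eq_intros DERIV_chain2[OF smooth_iterated_DERIV[OF assms]] refl)+ simp
  then show "(\<lambda>x. c * a ^ n * (deriv ^^ n) f (a * x + b)) differentiable at x"
    unfolding real_differentiable_def by blast
qed

lemma iterated_deriv_diff:
  assumes "smooth f" "smooth g"
  shows "(deriv ^^ n) (f - g) = (deriv ^^ n) f - (deriv ^^ n) g"
proof (induction n)
  case (Suc n)
  have "((deriv ^^ n) f - (deriv ^^ n) g has_real_derivative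
          ((deriv ^^ Suc n) f x - (deriv ^^ Suc n) g x)) (at x)" for x
    unfolding fun_diff_def
    by (intro DERIV_diff smooth_iterated_DERIV assms)
  then have "deriv ((deriv ^^ n) f - (deriv ^^ n) g) = (deriv ^^ Suc n) f - (deriv ^^ Suc n) g"
    by (simp add: fun_eq_iff DERIV_imp_deriv)
  then show ?case
    using Suc by (simp only: funpow.simps comp_apply)
qed simp

lemma iterated_deriv_uminus:
  assumes "smooth f"
  shows "(deriv ^^ n) (- f) = - (deriv ^^ n) f"
  using iterated_deriv_affine[OF assms, of n "-1" 1 0] by (simp add: fun_Compl_def)

lemma smooth_diff:
  assumes "smooth f" "smooth g"
  shows "smooth (f - g)"
  unfolding smooth_def iterated_deriv_diff[OF assms]
  using assms by (simp add: smooth_def fun_diff_def)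

lemma smooth_uminus: "smooth f \<Longrightarrow> smooth (- f)"
  using smooth_affine[of f "-1" 1 0] by (simp add: fun_Compl_def)

lemma smooth_0: "smooth 0"
proof -
  have "(deriv ^^ n) 0 = (\<lambda>x. 0::real)" for n
    by (induction n) (auto simp: zero_fun_def)
  then show ?thesis
    by (simp add: smooth_def)
qed

section \<open>Vanishing and boundedness of iterated derivatives\<close>

lemma iterated_deriv_eq_0_on_open:
  fixes f :: "real \<Rightarrow> real"
  assumes "open S" "\<And>x. x \<in> S \<Longrightarrow> f x = 0" "x \<in> S"
  shows "(deriv ^^ n) f x = 0"
  using assms(3)
proof (induction n arbitrary: x)
  case (Suc n)
  have "((deriv ^^ n) f has_real_derivative 0) (at x)"
    using has_field_derivative_transform_within_open[OF DERIV_const \<open>open S\<close> Suc.prems] Suc.IH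
    by metis
  then show ?case
    by (simp add: DERIV_imp_deriv)
qed (use assms in auto)

lemma iterated_deriv_eq_0_outside_support:
  fixes f :: "real \<Rightarrow> real"
  assumes "closure {x. f x \<noteq> 0} \<subseteq> K" "x \<notin> K"
  shows "(deriv ^^ n) f x = 0"
proof (rule iterated_deriv_eq_0_on_open)
  show "open (- closure {x. f x \<noteq> 0})" by auto
  show "f y = 0" if "y \<in> - closure {x. f x \<noteq> 0}" for y
    using that closure_subset[of "{x. f x \<noteq> 0}"] by auto
  show "x \<in> - closure {x. f x \<noteq> 0}"
    using assms by blast
qed

lemma smooth_bounded_on_compact:
  assumes "smooth f" "compact K"
  shows "bdd_above ((\<lambda>x. \<bar>(deriv ^^ j) f x\<bar>) ` K)"
  by (intro bounded_imp_bdd_above compact_imp_bounded compact_continuous_image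
      continuous_intros smooth_iterated_continuous_on assms)

lemma iterated_deriv_bounded:
  assumes "f \<in> test_functions_on K" "compact K"
  shows "\<exists>B. \<forall>j\<le>m. \<forall>x. \<bar>(deriv ^^ j) f x\<bar> \<le> B"
proof -
  have "\<exists>B. \<forall>x. \<bar>(deriv ^^ j) f x\<bar> \<le> B" for j
  proof -
    obtain B where B: "\<bar>(deriv ^^ j) f x\<bar> \<le> B" if "x \<in> K" for x
      using smooth_bounded_on_compact[of f K j] assms
      unfolding bdd_above_def test_functions_on_def by blast
    \<comment> \<open>For empty \<open>K\<close> the constant \<open>B\<close> may be negative,
      whereas the derivative is 0 off \<open>K\<close>; hence the maximum with 0.\<close>
    have "\<bar>(deriv ^^ j) f x\<bar> \<le> max B 0" for x
    proof (cases "x \<in> K")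
      case False
      then show ?thesis
        using iterated_deriv_eq_0_outside_support[of f K x j] assms by (simp add: test_functions_on_def)
    qed (use B in fastforce)
    then show ?thesis by blast
  qed
  then obtain B where B: "\<And>j x. \<bar>(deriv ^^ j) f x\<bar> \<le> B j"
    by metis
  have "\<bar>(deriv ^^ j) f x\<bar> \<le> Max (B ` {..m})" if "j \<le> m" for j x
    using B[of j x] that by (meson Max_ge atMost_iff finite_atMost finite_imageI image_eqI order_trans)
  then show ?thesis by blast
qed

subsection \<open>A bump function\<close>

text \<open>The polynomial in 1/x is carried along so that differentiation stays inside the
  family.\<close>

definition flat_exp :: "real poly \<Rightarrow> real \<Rightarrow> real"
  where "flat_exp p x = (if x > 0 then poly p (1 / x) * exp (- (1 / x)) else 0)"

lemma tendsto_poly_mult_exp_neg: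
  "((\<lambda>y::real. poly p y * exp (- y)) \<longlongrightarrow> 0) at_top"
proof -
  have "((\<lambda>y::real. \<Sum>i\<le>degree p. coeff p i * (y ^ i / exp y)) \<longlongrightarrow> (\<Sum>i\<le>degree p. coeff p i * 0)) at_top"
    by (intro tendsto_intros tendsto_power_div_exp_0)
  then show ?thesis
    by (simp add: poly_altdef exp_minus sum_distrib_right divide_inverse mult.assoc)
qed

text \<open>With u = 1/x and u' = -u^2, the derivative of p(u) exp(-u) is u^2 (p(u) - p'(u))
  exp(-u), and \<open>monom 1 2\<close> is the factor u^2. At 0 both one-sided difference quotients
  tend to 0.\<close>

lemma flat_exp_DERIV:
  "(flat_exp p has_real_derivative flat_exp (monom 1 2 * (p - pderiv p)) x) (at x)"
proof -
  consider "x > 0" | "x < 0" | "x = 0" by linarith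
  then show ?thesis
  proof cases
    case 1
    have "((\<lambda>x. poly p (1 / x) * exp (- (1 / x))) has_real_derivative
            flat_exp (monom 1 2 * (p - pderiv p)) x) (at x)"
      using 1
      by (auto intro!: derivative_eq_intros DERIV_chain2[OF poly_DERIV]
          simp: flat_exp_def poly_monom field_simps power2_eq_square)
    then show ?thesis
      by (rule has_field_derivative_transform_within_open[where S="{0<..}"])
        (use 1 in \<open>auto simp: flat_exp_def\<close>)
  next
    case 2
    have "((\<lambda>x. 0) has_real_derivative flat_exp (monom 1 2 * (p - pderiv p)) x) (at x)"
      using 2 by (simp add: flat_exp_def)
    then show ?thesis
      by (rule has_field_derivative_transform_within_open[where S="{..<0}"])
        (use 2 in \<open>auto simp: flat_exp_def\<close>)
  next
    case 3
    have "((\<lambda>h. flat_exp p h / h) \<longlongrightarrow> 0) (at_right 0)"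
    proof -
      \<comment> \<open>Division by h is multiplication by u = 1/h, which turns \<open>p\<close>
        into \<open>pCons 0 p\<close>; exponential decay in u still wins.\<close>
      have "((\<lambda>h::real. poly (pCons 0 p) (inverse h) * exp (- inverse h)) \<longlongrightarrow> 0) (at_right 0)"
        by (rule filterlim_compose[OF tendsto_poly_mult_exp_neg filterlim_inverse_at_top_right])
      moreover have "\<forall>\<^sub>F h in at_right 0.
          poly (pCons 0 p) (inverse h) * exp (- inverse h) = flat_exp p h / h"
        using eventually_at_right_less[of 0]
        by eventually_elim (simp add: flat_exp_def field_simps)
      ultimately show ?thesis
        by (rule Lim_transform_eventually)
    qed
    moreover have "((\<lambda>h. flat_exp p h / h) \<longlongrightarrow> 0) (at_left 0)"
      by (rule Lim_transform_eventually[OF tendsto_const])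
        (auto simp: eventually_at_left_field flat_exp_def intro!: exI[of _ "-1"])
    ultimately have "((\<lambda>h. flat_exp p h / h) \<longlongrightarrow> 0) (at 0)"
      by (simp add: filterlim_split_at)
    then show ?thesis
      using 3 by (simp add: DERIV_def flat_exp_def)
  qed
qed

text \<open>Each element has a derivative in the same set, so all elements are smooth; no Leibniz formula
  is needed.\<close>

inductive_set bump_algebra :: "(real \<Rightarrow> real) set" where
  left: "(\<lambda>x. flat_exp p (1 + x)) \<in> bump_algebra"
| right: "(\<lambda>x. flat_exp p (1 - x)) \<in> bump_algebra"
| add: "f \<in> bump_algebra \<Longrightarrow> g \<in> bump_algebra \<Longrightarrow> (\<lambda>x. f x + g x) \<in> bump_algebra"
| mult: "f \<in> bump_algebra \<Longrightarrow> g \<in> bump_algebra \<Longrightarrow> (\<lambda>x. f x * g x) \<in> bump_algebra"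

lemma bump_algebra_DERIV:
  assumes "f \<in> bump_algebra"
  shows "\<exists>f'\<in>bump_algebra. \<forall>x. (f has_real_derivative f' x) (at x)"
  using assms
proof induction
  case (left p)
  have "((\<lambda>x. 1 + x) has_real_derivative 1) (at x)" for x :: real
    by (auto intro!: derivative_eq_intros)
  from DERIV_chain2[OF flat_exp_DERIV this]
  have "((\<lambda>x. flat_exp p (1 + x)) has_real_derivative
      flat_exp (monom 1 2 * (p - pderiv p)) (1 + x)) (at x)" for x
    by simp
  then show ?case
    by (intro bexI[OF _ bump_algebra.left]) auto
next
  case (right p)
  \<comment> \<open>The sign from the inner derivative of 1 - x is absorbed into the
    polynomial.\<close>
  have *: "flat_exp (- q) x = - flat_exp q x" for q x
    by (simp add: flat_exp_def)
  have "((\<lambda>x. 1 - x) has_real_derivative - 1) (at x)" for x :: real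
    by (auto intro!: derivative_eq_intros)
  from DERIV_chain2[OF flat_exp_DERIV this]
  have "((\<lambda>x. flat_exp p (1 - x)) has_real_derivative
      flat_exp (- (monom 1 2 * (p - pderiv p))) (1 - x)) (at x)" for x
    unfolding * by simp
  then show ?case
    by (intro bexI[OF _ bump_algebra.right]) auto
next
  case (add f g)
  then obtain f' g' where fg: "f' \<in> bump_algebra" "g' \<in> bump_algebra"
    and "\<And>x. (f has_real_derivative f' x) (at x)" "\<And>x. (g has_real_derivative g' x) (at x)"
    by blast
  then have "((\<lambda>x. f x + g x) has_real_derivative f' x + g' x) (at x)" for x
    by (intro DERIV_add)
  with bump_algebra.add[OF fg] show ?case
    by (intro bexI[of _ "\<lambda>x. f' x + g' x"]) auto
next
  case (mult f g)
  then obtain f' g' where fg: "f' \<in> bump_algebra" "g' \<in> bump_algebra"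
    and "\<And>x. (f has_real_derivative f' x) (at x)" "\<And>x. (g has_real_derivative g' x) (at x)"
    by blast
  then have "((\<lambda>x. f x * g x) has_real_derivative f' x * g x + g' x * f x) (at x)" for x
    by (intro DERIV_mult)
  moreover have "(\<lambda>x. f' x * g x + g' x * f x) \<in> bump_algebra"
    using bump_algebra.add[OF bump_algebra.mult bump_algebra.mult] fg mult by blast
  ultimately show ?case
    by (intro bexI[of _ "\<lambda>x. f' x * g x + g' x * f x"]) auto
qed

lemma bump_algebra_smooth:
  assumes "f \<in> bump_algebra"
  shows "smooth f"
proof -
  have "(deriv ^^ n) f \<in> bump_algebra" for n
  proof (induction n)
    case (Suc n)
    then obtain f' where "f' \<in> bump_algebra" "\<And>x. ((deriv ^^ n) f has_real_derivative f' x) (at x)"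
      using bump_algebra_DERIV by blast
    moreover from this have "deriv ((deriv ^^ n) f) = f'"
      by (intro ext DERIV_imp_deriv)
    ultimately show ?case by simp
  qed (use assms in simp)
  then show ?thesis
    unfolding smooth_def real_differentiable_def using bump_algebra_DERIV by blast
qed

text \<open>On (-1, 1) this is exp(-2 / (1 - x^2)), the classical bump function.\<close>

definition bump :: "real \<Rightarrow> real"
  where "bump x = flat_exp 1 (1 + x) * flat_exp 1 (1 - x)"

lemma smooth_bump: "smooth bump"
  unfolding bump_def[abs_def]
  by (intro bump_algebra_smooth bump_algebra.intros)

lemma bump_eq_0: "\<bar>x\<bar> \<ge> 1 \<Longrightarrow> bump x = 0"
  by (auto simp: bump_def flat_exp_def)

lemma bump_0_pos: "bump 0 > 0"
  by (simp add: bump_def flat_exp_def)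

lemma bump_test_function: "bump \<in> test_functions_on {-1..1}"
proof -
  have "closure {x. bump x \<noteq> 0} \<subseteq> {-1..1}"
    by (rule closure_minimal) (use bump_eq_0 in \<open>auto simp: abs_if split: if_splits\<close>, smt+)
  then show ?thesis
    by (simp add: test_functions_on_def smooth_bump)
qed

subsection \<open>Topologies generated by seminorms\<close>

lemma seminorm_topology_ball_open:
  assumes "p \<in> P" "x \<in> E" "\<epsilon> > 0"
  shows "openin (seminorm_topology E P) {y \<in> E. p (y - x) < \<epsilon>}"
  unfolding seminorm_topology_def
  by (rule topology_generated_by_Basis) (use assms in blast)

lemma topspace_seminorm_topology:
  assumes "P \<noteq> {}"
  shows "topspace (seminorm_topology E P) = E"
proof
  show "topspace (seminorm_topology E P) \<subseteq> E"
    unfolding seminorm_topology_def topology_generated_by_topspace by blast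
next
  obtain p where p: "p \<in> P" using assms by blast
  show "E \<subseteq> topspace (seminorm_topology E P)"
  proof
    fix x assume x: "x \<in> E"
    have "x \<in> {y \<in> E. p (y - x) < \<bar>p 0\<bar> + 1}"
      using x by simp
    moreover have "openin (seminorm_topology E P) {y \<in> E. p (y - x) < \<bar>p 0\<bar> + 1}"
      by (rule seminorm_topology_ball_open) (use p x in auto)
    ultimately show "x \<in> topspace (seminorm_topology E P)"
      using openin_subset by blast
  qed
qed

text \<open>The balls of integer radius around 0 are an open cover of \<open>C\<close>, and a finite
  subcover bounds \<open>p\<close>.\<close>

lemma compactin_seminorm_topology_bounded:
  assumes C: "compactin (seminorm_topology E P) C" and p: "p \<in> P" and "0 \<in> E"
  shows "\<exists>M. \<forall>f\<in>C. p f \<le> M"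
proof -
  let ?B = "\<lambda>n::nat. {y \<in> E. p (y - 0) < Suc n}"
  have "C \<subseteq> E"
    using compactin_subset_topspace[OF C] topspace_seminorm_topology[of P E] p by blast
  moreover have "\<exists>n. p y < real (Suc n)" for y
    using reals_Archimedean2[of "p y"] by (metis less_Suc_eq of_nat_less_iff order_less_trans)
  ultimately have "C \<subseteq> \<Union> (range ?B)"
    by (auto simp del: of_nat_Suc)
  moreover have "\<forall>U\<in>range ?B. openin (seminorm_topology E P) U"
    using seminorm_topology_ball_open[OF p \<open>0 \<in> E\<close>] by auto
  ultimately obtain \<F> where \<F>: "finite \<F>" "\<F> \<subseteq> range ?B" "C \<subseteq> \<Union> \<F>"
    using C unfolding compactin_def by meson
  then obtain I where I: "finite I" "\<F> = ?B ` I"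
    by (meson finite_subset_image)
  \<comment> \<open>An element of \<open>C\<close> forces \<open>I\<close> to be nonempty, so
    \<open>Max I\<close> is a genuine maximum.\<close>
  have "p f \<le> Suc (Max I)" if f: "f \<in> C" for f
  proof -
    obtain n where n: "n \<in> I" "p f < Suc n"
      using f \<F> I by auto
    then have "n \<le> Max I" using I by simp
    then show ?thesis using n by simp
  qed
  then show ?thesis by blast
qed

text \<open>Subbasic balls may have any centre x, but one that contains 0 also contains the ball
  around 0 of radius \<epsilon> - p x. Induction over the generation of the topology does the rest:
  an intersection merges the finite families and takes the smaller radius.\<close>

lemma seminorm_topology_nhds_0:
  assumes U: "openin (seminorm_topology E P) U" "0 \<in> U"
    and tri: "\<And>p x y. p \<in> P \<Longrightarrow> x \<in> E \<Longrightarrow> y \<in> E \<Longrightarrow> p (y - x) \<le> p y + p x"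
    and sym: "\<And>p x. p \<in> P \<Longrightarrow> x \<in> E \<Longrightarrow> p (- x) = p x"
  shows "\<exists>F \<epsilon>. finite F \<and> F \<subseteq> P \<and> \<epsilon> > 0 \<and> {y \<in> E. \<forall>p\<in>F. p y < \<epsilon>} \<subseteq> U"
  using U unfolding seminorm_topology_def openin_topology_generated_by_iff
proof induction
  case (Int U V)
  then obtain F G \<delta> \<epsilon> where
    "finite F" "F \<subseteq> P" "\<delta> > 0" "{y \<in> E. \<forall>p\<in>F. p y < \<delta>} \<subseteq> U"
    "finite G" "G \<subseteq> P" "\<epsilon> > 0" "{y \<in> E. \<forall>p\<in>G. p y < \<epsilon>} \<subseteq> V"
    by auto
  then show ?case
    by (intro exI[of _ "F \<union> G"] exI[of _ "min \<delta> \<epsilon>"]) auto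
next
  case (UN K)
  then obtain V where "V \<in> K" "0 \<in> V" by blast
  with UN.IH show ?case by (meson Union_upper subset_trans)
next
  case (Basis s)
  then obtain p x \<epsilon> where s: "s = {y \<in> E. p (y - x) < \<epsilon>}" "p \<in> P" "x \<in> E" "\<epsilon> > 0"
    by blast
  then have "p x < \<epsilon>"
    using Basis(2) sym[of p x] by simp
  moreover have "{y \<in> E. \<forall>q\<in>{p}. q y < \<epsilon> - p x} \<subseteq> s"
    using s tri by fastforce
  ultimately show ?case
    using s by (intro exI[of _ "{p}"] exI[of _ "\<epsilon> - p x"]) auto
qed simp

subsection \<open>The non-compactness argument\<close>

text \<open>Only \<open>nhds\<close> and \<open>bdd\<close> say anything specific about the
  topology, so the argument covers intermediate spaces and the Schwartz space alike, without first
  embedding the test functions continuously into the latter.\<close>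

lemma composition_not_compact:
  assumes smooth: "topspace X \<subseteq> {f. smooth f}"
    and nhds: "\<And>V K. openin X V \<Longrightarrow> 0 \<in> V \<Longrightarrow> compact K \<Longrightarrow>
      \<exists>m \<epsilon>. \<epsilon> > 0 \<and> (\<forall>f\<in>test_functions_on K. (\<forall>j\<le>m. \<forall>x. \<bar>(deriv ^^ j) f x\<bar> \<le> \<epsilon>) \<longrightarrow> f \<in> V)"
    and bdd: "\<And>C n a b. compactin X C \<Longrightarrow> \<exists>M. \<forall>f\<in>C. \<forall>x\<in>{a..b}. \<bar>(deriv ^^ n) f x\<bar> \<le> M"
    and \<phi>: "smooth \<phi>" "\<not> \<phi> constant_on UNIV"
    and comp: "\<And>f. f \<in> topspace X \<Longrightarrow> f \<circ> \<phi> \<in> topspace X"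
  shows "\<not> compact_operator X X (\<lambda>f. f \<circ> \<phi>)"
proof
  let ?C = "\<lambda>f. f \<circ> \<phi>"
  assume "compact_operator X X ?C"
  then obtain U V where U: "U \<subseteq> topspace X" and V: "openin X V" "0 \<in> V" "V \<subseteq> U"
    and cpt: "compactin X (X closure_of (?C ` U))"
    unfolding compact_operator_def zero_neighbourhood_def by blast
  have "?C ` U \<subseteq> topspace X"
    using U comp by blast
  then have CU: "?C ` U \<subseteq> X closure_of (?C ` U)"
    by (rule closure_of_subset)
  note \<phi>_DERIV = smooth_imp_DERIV[OF \<phi>(1)]
  obtain x0 where x0: "deriv \<phi> x0 \<noteq> 0"
    using DERIV_isconst_all[of \<phi>] \<phi>_DERIV \<phi>(2) unfolding constant_on_def by metis
  define y0 where "y0 = \<phi> x0"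
  define D where "D = \<bar>deriv \<phi> x0\<bar>"
  have D: "D > 0" using x0 by (simp add: D_def)
  \<comment> \<open>Near \<open>x0\<close> the difference quotient is within D/2 of a number of
    modulus D, so \<phi> leaves \<open>y0\<close> with speed at least D/2.\<close>
  obtain d where d: "d > 0"
    and away: "\<And>h. h \<noteq> 0 \<Longrightarrow> \<bar>h\<bar> < d \<Longrightarrow> \<bar>\<phi> (x0 + h) - y0\<bar> \<ge> D / 2 * \<bar>h\<bar>"
  proof -
    have "(\<lambda>h. (\<phi> (x0 + h) - \<phi> x0) / h) \<midarrow>0\<rightarrow> deriv \<phi> x0"
      using \<phi>_DERIV[of x0] by (simp add: DERIV_def)
    from LIM_D[OF this, of "D / 2"] obtain d where "d > 0" and
      d: "\<And>h. h \<noteq> 0 \<Longrightarrow> \<bar>h\<bar> < d \<Longrightarrow> \<bar>(\<phi> (x0 + h) - \<phi> x0) / h - deriv \<phi> x0\<bar> < D / 2"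
      using D by auto
    have "\<bar>\<phi> (x0 + h) - y0\<bar> \<ge> D / 2 * \<bar>h\<bar>" if "h \<noteq> 0" "\<bar>h\<bar> < d" for h
    proof -
      have "\<bar>(\<phi> (x0 + h) - \<phi> x0) / h\<bar> \<ge> D / 2"
        using d[OF that] unfolding D_def by linarith
      then show ?thesis
        using that by (simp add: y0_def abs_divide field_simps)
    qed
    then show ?thesis using that \<open>d > 0\<close> by blast
  qed
  \<comment> \<open>This interval contains the supports of the bumps for all t \<le> 1, so
    \<open>m\<close> and \<epsilon> do not depend on t.\<close>
  obtain m \<epsilon> where \<epsilon>: "\<epsilon> > 0"
    and inV: "\<And>f. f \<in> test_functions_on {y0-1..y0+1} \<Longrightarrow> (\<And>j x. j \<le> m \<Longrightarrow> \<bar>(deriv ^^ j) f x\<bar> \<le> \<epsilon>) \<Longrightarrow> f \<in> V"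
    using nhds[OF V(1,2), of "{y0-1..y0+1}"] compact_Icc by meson
  \<comment> \<open>The order exceeds by one what the neighbourhood controls; this gap produces the
    surplus factor t.\<close>
  obtain M0 where M0: "\<And>f x. f \<in> U \<Longrightarrow> x \<in> {x0..x0+d} \<Longrightarrow> \<bar>(deriv ^^ Suc m) (f \<circ> \<phi>) x\<bar> \<le> M0"
    using bdd[OF cpt, of x0 "x0 + d" "Suc m"] CU by blast
  \<comment> \<open>The sign of \<open>M0\<close> is unknown if \<open>U\<close> is not inspected
    further; the shift makes the bound positive.\<close>
  define M where "M = \<bar>M0\<bar> + 1"
  obtain B0 where B0: "\<And>j x. j \<le> m \<Longrightarrow> \<bar>(deriv ^^ j) bump x\<bar> \<le> B0"
    using iterated_deriv_bounded[OF bump_test_function, of m] by auto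
  define B where "B = \<bar>B0\<bar> + 1"
  have B: "B > 0"
    by (simp add: B_def)
  have bump_le_B: "\<bar>(deriv ^^ j) bump x\<bar> \<le> B" if "j \<le> m" for j x
    using B0[OF that, of x] unfolding B_def by linarith
  define \<eta> where "\<eta> = \<epsilon> / B"
  have \<eta>: "\<eta> > 0" using \<epsilon> B by (simp add: \<eta>_def)
  \<comment> \<open>At speed D/2 a step of length r t moves \<phi> by at least 2 t, beyond the
    half-width t of the bump.\<close>
  define r where "r = 4 / D"
  have r: "r > 0" using D by (simp add: r_def)
  \<comment> \<open>The common factor t^m is already cancelled. The left side is a positive
    constant, so small t will contradict this.\<close>
  have key: "\<eta> * bump 0 \<le> M * r ^ Suc m * t" if t: "0 < t" "t \<le> 1" "r * t < d" for t
  proof -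
    \<comment> \<open>The argument (y - y0) / t is spelled out in the shape required by
      \<open>iterated_deriv_affine\<close>.\<close>
    define f where "f = (\<lambda>y. \<eta> * t ^ m * bump (1 / t * y + (- y0 / t)))"
    have f_eq: "f y = \<eta> * t ^ m * bump ((y - y0) / t)" for y
      by (simp add: f_def diff_divide_distrib)
    have f0: "f y = 0" if "\<bar>y - y0\<bar> \<ge> t" for y
      using that t by (simp add: f_eq bump_eq_0 abs_divide)
    have "closure {y. f y \<noteq> 0} \<subseteq> {y0-1..y0+1}"
    proof (rule closure_minimal)
      show "{y. f y \<noteq> 0} \<subseteq> {y0-1..y0+1}"
        using f0 t by (smt (verit) atLeastAtMost_iff mem_Collect_eq subsetI)
    qed simp
    then have "f \<in> test_functions_on {y0-1..y0+1}"
      using smooth_affine[OF smooth_bump] by (simp only: test_functions_on_def f_def mem_Collect_eq)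
    moreover have "\<bar>(deriv ^^ j) f y\<bar> \<le> \<epsilon>" if j: "j \<le> m" for j y
    proof -
      \<comment> \<open>Each derivative costs a factor 1/t; at most m of them occur, and t^m pays
        for all.\<close>
      have "t ^ m * (1 / t) ^ j = t ^ (m - j)"
        using j t by (simp add: power_diff power_one_over)
      then have "(deriv ^^ j) f y = \<eta> * t ^ (m - j) * (deriv ^^ j) bump (1 / t * y + (- y0 / t))"
        unfolding f_def iterated_deriv_affine[OF smooth_bump] by (simp only: mult.assoc)
      then have "\<bar>(deriv ^^ j) f y\<bar> = \<eta> * t ^ (m - j) * \<bar>(deriv ^^ j) bump (1 / t * y + (- y0 / t))\<bar>"
        using \<eta> t by (simp add: abs_mult)
      also have "\<dots> \<le> \<eta> * 1 * B"
        using \<eta> t B bump_le_B[OF j] by (intro mult_mono mult_left_mono power_le_one) auto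
      also have "\<dots> = \<epsilon>" using B by (simp add: \<eta>_def)
      finally show ?thesis .
    qed
    ultimately have "f \<in> U"
      using inV V by blast
    define h where "h = f \<circ> \<phi>"
    have "h \<in> topspace X"
      using \<open>f \<in> U\<close> U comp by (auto simp: h_def)
    then have h_smooth: "smooth h" using smooth by blast
    define x1 where "x1 = x0 + r * t"
    have x1: "x0 < x1" "x1 < x0 + d" using r t by (auto simp: x1_def)
    have "2 * t = D / 2 * \<bar>r * t\<bar>"
      using D t by (simp add: r_def)
    also have "\<dots> \<le> \<bar>\<phi> x1 - y0\<bar>"
      unfolding x1_def using r t by (intro away) auto
    finally have "\<bar>\<phi> x1 - y0\<bar> \<ge> 2 * t" .
    \<comment> \<open>The margin between 2 t and t yields a strict inequality, hence an open set
      around \<open>x1\<close> on which \<open>h\<close> vanishes.\<close>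
    then have "x1 \<in> {x. \<bar>\<phi> x - y0\<bar> > t}"
      using t by simp
    moreover have "open {x. \<bar>\<phi> x - y0\<bar> > t}"
      by (intro open_Collect_less continuous_intros)
        (use smooth_iterated_continuous_on[OF \<phi>(1), of _ 0] in simp)
    ultimately have flat: "(deriv ^^ n) h x1 = 0" for n
      using iterated_deriv_eq_0_on_open[of "{x. \<bar>\<phi> x - y0\<bar> > t}" h x1 n] f0 by (simp add: h_def)
    \<comment> \<open>The expansion is centred at \<open>x1\<close>, where all derivatives vanish,
      and evaluated at \<open>x0\<close>: only the remainder survives.\<close>
    obtain \<xi> where \<xi>: "x0 < \<xi>" "\<xi> < x1" and
      "h x0 = (\<Sum>k<Suc m. (deriv ^^ k) h x1 / fact k * (x0 - x1) ^ k)
              + (deriv ^^ Suc m) h \<xi> / fact (Suc m) * (x0 - x1) ^ Suc m"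
      using Taylor[of "Suc m" "\<lambda>k. (deriv ^^ k) h" h x0 x1 x1 x0]
        smooth_iterated_DERIV[OF h_smooth] x1 by auto
    then have "h x0 = (deriv ^^ Suc m) h \<xi> / fact (Suc m) * (x0 - x1) ^ Suc m"
      by (simp add: flat del: funpow.simps)
    then have "\<bar>h x0\<bar> = \<bar>(deriv ^^ Suc m) h \<xi>\<bar> / fact (Suc m) * (r * t) ^ Suc m"
      using r t by (simp add: abs_mult power_abs x1_def del: funpow.simps power_Suc fact_Suc)
    also have "\<dots> \<le> M / 1 * (r * t) ^ Suc m"
    proof -
      have "\<bar>(deriv ^^ Suc m) h \<xi>\<bar> \<le> M"
        using M0[OF \<open>f \<in> U\<close>, of \<xi>] \<xi> x1 by (simp add: h_def M_def del: funpow.simps)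
      then show ?thesis
        using r t by (intro mult_right_mono frac_le) (auto simp del: funpow.simps fact_Suc simp: M_def)
    qed
    finally have "\<eta> * t ^ m * bump 0 \<le> M * (r * t) ^ Suc m"
      using \<eta> t bump_0_pos by (simp add: h_def f_eq y0_def abs_mult del: power_Suc)
    then have "t ^ m * (\<eta> * bump 0) \<le> t ^ m * (M * r ^ Suc m * t)"
      by (simp add: power_mult_distrib mult_ac)
    then show ?thesis
      using t by simp
  qed
  define A where "A = M * r ^ Suc m"
  have A: "A > 0"
    using r by (simp add: A_def M_def)
  \<comment> \<open>The three entries ensure t \<le> 1, r t < d, and that A t is at most half of
    \<eta> bump(0).\<close>
  define t where "t = Min {1, d / (2 * r), \<eta> * bump 0 / (2 * A)}"
  have t: "t > 0" "t \<le> 1" "t \<le> d / (2 * r)" "t \<le> \<eta> * bump 0 / (2 * A)"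
    using \<eta> d r A bump_0_pos by (auto simp: t_def)
  have "r * t < d"
    using t(3) r d by (simp add: field_simps)
  with key t have "\<eta> * bump 0 \<le> A * t" by (simp add: A_def)
  moreover have "A * t \<le> \<eta> * bump 0 / 2"
    using t(4) A by (simp add: field_simps)
  ultimately show False
    using \<eta> bump_0_pos by (smt (verit) field_sum_of_halves mult_pos_pos)
qed

subsection \<open>Smooth functions and test functions\<close>

definition Cinf_seminorm :: "real set \<Rightarrow> nat \<Rightarrow> (real \<Rightarrow> real) \<Rightarrow> real"
  where "Cinf_seminorm K j f = (SUP x\<in>K. \<bar>(deriv ^^ j) f x\<bar>)"

lemma Cinf_topology_eq:
  "Cinf_topology = seminorm_topology {f. smooth f} {Cinf_seminorm K j | K j. compact K \<and> K \<noteq> {}}"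
  unfolding Cinf_topology_def Cinf_seminorm_def[abs_def] by simp

lemma topspace_Cinf_topology: "topspace Cinf_topology = {f. smooth f}"
  unfolding Cinf_topology_eq by (rule topspace_seminorm_topology) (use compact_sing in blast)

lemma Cinf_seminorm_diff:
  assumes "smooth f" "smooth g" "compact K" "K \<noteq> {}"
  shows "Cinf_seminorm K j (f - g) \<le> Cinf_seminorm K j f + Cinf_seminorm K j g"
  unfolding Cinf_seminorm_def
proof (rule cSUP_least[OF \<open>K \<noteq> {}\<close>])
  fix x assume "x \<in> K"
  then have "\<bar>(deriv ^^ j) f x\<bar> \<le> (SUP x\<in>K. \<bar>(deriv ^^ j) f x\<bar>)"
    "\<bar>(deriv ^^ j) g x\<bar> \<le> (SUP x\<in>K. \<bar>(deriv ^^ j) g x\<bar>)"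
    using assms by (auto intro!: cSUP_upper smooth_bounded_on_compact)
  then show "\<bar>(deriv ^^ j) (f - g) x\<bar> \<le>
      (SUP x\<in>K. \<bar>(deriv ^^ j) f x\<bar>) + (SUP x\<in>K. \<bar>(deriv ^^ j) g x\<bar>)"
    using assms by (simp add: iterated_deriv_diff)
qed

text \<open>A global bound controls the supremum over every compact set, so of the finitely many
  seminorms involved only the largest order matters.\<close>

lemma Cinf_nhds_0:
  assumes "openin Cinf_topology U" "0 \<in> U"
  shows "\<exists>m \<epsilon>. \<epsilon> > 0 \<and> (\<forall>f. smooth f \<longrightarrow> (\<forall>j\<le>m. \<forall>x. \<bar>(deriv ^^ j) f x\<bar> \<le> \<epsilon>) \<longrightarrow> f \<in> U)"
proof -
  let ?P = "{Cinf_seminorm K j | K j. compact K \<and> K \<noteq> {}}"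
  have "\<exists>F \<epsilon>. finite F \<and> F \<subseteq> ?P \<and> \<epsilon> > 0 \<and> {y \<in> {f. smooth f}. \<forall>p\<in>F. p y < \<epsilon>} \<subseteq> U"
  proof (rule seminorm_topology_nhds_0[OF assms[unfolded Cinf_topology_eq]])
    show "p (g - f) \<le> p g + p f" if "p \<in> ?P" "f \<in> {f. smooth f}" "g \<in> {f. smooth f}" for p f g
      using that Cinf_seminorm_diff by auto
    show "p (- f) = p f" if "p \<in> ?P" "f \<in> {f. smooth f}" for p f
      using that by (auto simp: Cinf_seminorm_def iterated_deriv_uminus)
  qed
  then obtain F \<epsilon> where F: "finite F" "F \<subseteq> ?P" "\<epsilon> > 0"
    "\<And>f. smooth f \<Longrightarrow> \<forall>p\<in>F. p f < \<epsilon> \<Longrightarrow> f \<in> U"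
    by blast
  have "\<exists>K j. p = Cinf_seminorm K j \<and> K \<noteq> {}" if "p \<in> F" for p
    using that F(2) by blast
  then obtain K J where KJ: "\<And>p. p \<in> F \<Longrightarrow> p = Cinf_seminorm (K p) (J p)" "\<And>p. p \<in> F \<Longrightarrow> K p \<noteq> {}"
    by metis
  \<comment> \<open>The bound is halved because a supremum of values below \<epsilon> may equal
    \<epsilon>.\<close>
  have "f \<in> U" if f: "smooth f" "\<forall>j\<le>Max (J ` F). \<forall>x. \<bar>(deriv ^^ j) f x\<bar> \<le> \<epsilon> / 2" for f
  proof (rule F(4)[OF f(1)], rule ballI)
    fix p assume p: "p \<in> F"
    then have "J p \<le> Max (J ` F)" using F(1) by simp
    then have "Cinf_seminorm (K p) (J p) f \<le> \<epsilon> / 2"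
      unfolding Cinf_seminorm_def using f(2) KJ(2)[OF p] by (intro cSUP_least) auto
    then show "p f < \<epsilon>"
      unfolding KJ(1)[OF p, symmetric] using F(3) by linarith
  qed
  then show ?thesis
    using F(3) by (intro exI[of _ "Max (J ` F)"] exI[of _ "\<epsilon> / 2"]) auto
qed

lemma Cinf_compact_bounded:
  assumes "compactin Cinf_topology C"
  shows "\<exists>M. \<forall>f\<in>C. \<forall>x\<in>{a..b}. \<bar>(deriv ^^ n) f x\<bar> \<le> M"
\<comment> \<open>An empty interval provides no seminorm, but then the claim is vacuous.\<close>
proof (cases "a \<le> b")
  case True
  then have "Cinf_seminorm {a..b} n \<in> {Cinf_seminorm K j | K j. compact K \<and> K \<noteq> {}}"
    using compact_Icc[of a b] by (intro CollectI exI[of _ "{a..b}"] exI[of _ n]) simp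
  then have "\<exists>M. \<forall>f\<in>C. Cinf_seminorm {a..b} n f \<le> M"
    using compactin_seminorm_topology_bounded[OF assms[unfolded Cinf_topology_eq]] smooth_0 by simp
  then obtain M where M: "\<And>f. f \<in> C \<Longrightarrow> Cinf_seminorm {a..b} n f \<le> M"
    by blast
  have "\<bar>(deriv ^^ n) f x\<bar> \<le> M" if "f \<in> C" "x \<in> {a..b}" for f x
  proof -
    have "smooth f"
      using that compactin_subset_topspace[OF assms] topspace_Cinf_topology by auto
    then have "\<bar>(deriv ^^ n) f x\<bar> \<le> Cinf_seminorm {a..b} n f"
      unfolding Cinf_seminorm_def using that by (intro cSUP_upper smooth_bounded_on_compact) auto
    with M[OF that(1)] show ?thesis by linarith
  qed
  then show ?thesis by blast
qed auto

section \<open>Test functions and their inductive limit topology\<close>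

lemma test_functions_on_subset:
  assumes "compact K"
  shows "test_functions_on K \<subseteq> test_functions"
proof -
  have "compact (closure A)" if "closure A \<subseteq> K" for A
    using closed_Int_compact[OF closed_closure assms] that by (metis Int_absorb2)
  then show ?thesis
    unfolding test_functions_on_def test_functions_def by blast
qed

lemma zero_mem_test_functions_on: "0 \<in> test_functions_on K"
  by (simp add: test_functions_on_def smooth_0)

text \<open>This makes the indiscrete topology on the test functions locally convex: its only
  nonempty open set is the whole subspace.\<close>

lemma subspace_test_functions: "subspace test_functions"
proof (rule subspaceI)
  show "0 \<in> test_functions"
    using zero_mem_test_functions_on test_functions_on_subset[OF compact_empty] by blast
next
  fix f g assume f: "f \<in> test_functions" and g: "g \<in> test_functions"
  have "smooth (f - (- g))"
    using f g by (intro smooth_diff smooth_uminus) (auto simp: test_functions_def)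
  moreover have "closure {x. (f + g) x \<noteq> 0} \<subseteq> closure {x. f x \<noteq> 0} \<union> closure {x. g x \<noteq> 0}"
    unfolding closure_Un[symmetric] by (rule closure_mono) auto
  moreover have "compact (closure {x. f x \<noteq> 0} \<union> closure {x. g x \<noteq> 0})"
    using f g by (auto simp: test_functions_def)
  ultimately show "f + g \<in> test_functions"
    using test_functions_on_subset[of "closure {x. f x \<noteq> 0} \<union> closure {x. g x \<noteq> 0}"]
    unfolding test_functions_on_def by (simp add: subset_iff)
next
  fix c f assume f: "f \<in> test_functions"
  then have "smooth (c *\<^sub>R f)"
    using smooth_affine[of f c 1 0] by (simp add: scaleR_fun_def test_functions_def)
  moreover have "closure {x. (c *\<^sub>R f) x \<noteq> 0} \<subseteq> closure {x. f x \<noteq> 0}"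
    by (rule closure_mono) (auto simp: scaleR_fun_def)
  ultimately show "c *\<^sub>R f \<in> test_functions"
    using f test_functions_on_subset[of "closure {x. f x \<noteq> 0}"]
    unfolding test_functions_on_def test_functions_def by blast
qed

text \<open>Without an admissible topology the supremum would have an empty carrier; the indiscrete one is
  admissible.\<close>

lemma topspace_test_function_topology: "test_functions \<subseteq> topspace test_function_topology"
proof -
  define \<tau> where "\<tau> = topology (\<lambda>U. U = {} \<or> U = test_functions)"
  have "istopology (\<lambda>U. U = {} \<or> U = test_functions)"
    unfolding istopology_def by auto
  then have open_iff: "openin \<tau> U \<longleftrightarrow> U = {} \<or> U = test_functions" for U
    by (simp add: \<tau>_def)
  have top: "topspace \<tau> = test_functions"
    unfolding topspace_def open_iff by auto
  \<comment> \<open>Stated for any source space, to cover addition, scalar multiplication and the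
    inclusions.\<close>
  have cont: "continuous_map S \<tau> h" if "h ` topspace S \<subseteq> test_functions" for S and h :: "'a \<Rightarrow> _"
  proof -
    have "{x \<in> topspace S. h x \<in> test_functions} = topspace S" using that by auto
    then show ?thesis
      using that unfolding continuous_map_def open_iff top by auto
  qed
  have "locally_convex_space \<tau>"
    unfolding locally_convex_space_def top
    using subspace_test_functions subspace_imp_convex[OF subspace_test_functions]
      subspace_add[OF subspace_test_functions] subspace_scale[OF subspace_test_functions]
    by (auto intro!: cont simp: top open_iff)
  moreover have "continuously_included (subtopology Cinf_topology (test_functions_on K)) \<tau>" if "compact K" for K
    unfolding continuously_included_def using test_functions_on_subset[OF that] by (intro cont) auto
  ultimately show ?thesis
    unfolding test_function_topology_def topology_generated_by_topspace
    using top open_iff by blast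
qed

text \<open>Continuity into a supremum of topologies can be tested on generating sets, and each of
  these is open in one admissible topology.\<close>

lemma test_functions_on_continuously_included:
  assumes "compact K"
  shows "continuously_included (subtopology Cinf_topology (test_functions_on K)) test_function_topology"
  unfolding continuously_included_def[of _ test_function_topology]
  unfolding test_function_topology_def
proof (rule continuous_on_generated_topo)
  let ?S = "subtopology Cinf_topology (test_functions_on K)"
  fix U
  assume "U \<in> {U. \<exists>\<tau>. locally_convex_space \<tau> \<and> topspace \<tau> = test_functions \<and>
          (\<forall>K. compact K \<longrightarrow>
             continuously_included (subtopology Cinf_topology (test_functions_on K)) \<tau>) \<and>
          openin \<tau> U}"
  then obtain \<tau> where "continuously_included ?S \<tau>" and U: "openin \<tau> U"
    using assms by blast
  then have "continuous_map ?S \<tau> (\<lambda>f. f)"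
    by (simp add: continuously_included_def)
  from openin_continuous_map_preimage[OF this U]
  show "openin ?S ((\<lambda>f. f) -` U \<inter> topspace ?S)"
    by (simp add: vimage_def Collect_conj_eq Int_ac)
next
  show "(\<lambda>f. f) ` topspace (subtopology Cinf_topology (test_functions_on K))
      \<subseteq> \<Union> {U. \<exists>\<tau>. locally_convex_space \<tau> \<and> topspace \<tau> = test_functions \<and>
          (\<forall>K. compact K \<longrightarrow>
             continuously_included (subtopology Cinf_topology (test_functions_on K)) \<tau>) \<and>
          openin \<tau> U}"
    using test_functions_on_subset[OF assms] topspace_test_function_topology
    unfolding test_function_topology_def topology_generated_by_topspace by auto
qed

text \<open>By continuity of the composed inclusion, \<open>V\<close> meets the functions supported
  in \<open>K\<close> in the trace of a neighbourhood of 0 in the space of smooth functions.\<close>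

lemma intermediate_space_nhds_0:
  assumes X: "continuously_included test_function_topology X"
    and V: "openin X V" "0 \<in> V" and K: "compact K"
  shows "\<exists>m \<epsilon>. \<epsilon> > 0 \<and> (\<forall>f\<in>test_functions_on K. (\<forall>j\<le>m. \<forall>x. \<bar>(deriv ^^ j) f x\<bar> \<le> \<epsilon>) \<longrightarrow> f \<in> V)"
proof -
  let ?S = "subtopology Cinf_topology (test_functions_on K)"
  have "continuous_map ?S X (\<lambda>f. f)"
    using test_functions_on_continuously_included[OF K] X continuous_map_compose
    unfolding continuously_included_def by (fastforce simp: o_def)
  then have "openin ?S {f \<in> topspace ?S. f \<in> V}"
    using V(1) by (rule openin_continuous_map_preimage)
  then obtain W where W: "openin Cinf_topology W" "{f \<in> topspace ?S. f \<in> V} = W \<inter> test_functions_on K"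
    unfolding openin_subtopology by blast
  have "0 \<in> topspace ?S"
    by (simp add: topspace_Cinf_topology smooth_0 zero_mem_test_functions_on)
  then have "0 \<in> W" using W V by blast
  with Cinf_nhds_0[OF W(1)] obtain m \<epsilon> where "\<epsilon> > 0"
    "\<And>f. smooth f \<Longrightarrow> \<forall>j\<le>m. \<forall>x. \<bar>(deriv ^^ j) f x\<bar> \<le> \<epsilon> \<Longrightarrow> f \<in> W"
    by blast
  then show ?thesis
    using W(2) by (intro exI[of _ m] exI[of _ \<epsilon>]) (auto simp: test_functions_on_def)
qed

subsection \<open>The Schwartz space\<close>

lemma schwartz_weight_upper:
  "j \<le> n \<Longrightarrow> (1 + \<bar>x\<bar>\<^sup>2) ^ n * \<bar>(deriv ^^ j) f x\<bar> \<le> schwartz_weight n f x"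
  unfolding schwartz_weight_def by (rule cSUP_upper) auto

lemma schwartz_weight_least:
  assumes "\<And>j. j \<le> n \<Longrightarrow> (1 + \<bar>x\<bar>\<^sup>2) ^ n * \<bar>(deriv ^^ j) f x\<bar> \<le> B"
  shows "schwartz_weight n f x \<le> B"
  unfolding schwartz_weight_def by (rule cSUP_least) (use assms in auto)

lemma schwartz_seminorm_upper:
  "f \<in> schwartz_space \<Longrightarrow> schwartz_weight n f x \<le> schwartz_seminorm n f"
  unfolding schwartz_seminorm_def schwartz_space_def by (intro cSUP_upper) auto

lemma schwartz_seminorm_least:
  "(\<And>x. schwartz_weight n f x \<le> B) \<Longrightarrow> schwartz_seminorm n f \<le> B"
  unfolding schwartz_seminorm_def by (rule cSUP_least) auto

text \<open>The weight is at least 1.\<close>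

lemma abs_iterated_deriv_le_schwartz_seminorm:
  assumes "f \<in> schwartz_space"
  shows "\<bar>(deriv ^^ n) f x\<bar> \<le> schwartz_seminorm n f"
proof -
  have "1 * \<bar>(deriv ^^ n) f x\<bar> \<le> (1 + \<bar>x\<bar>\<^sup>2) ^ n * \<bar>(deriv ^^ n) f x\<bar>"
    by (intro mult_right_mono one_le_power) auto
  also have "\<dots> \<le> schwartz_weight n f x"
    by (rule schwartz_weight_upper) simp
  also have "\<dots> \<le> schwartz_seminorm n f"
    by (rule schwartz_seminorm_upper[OF assms])
  finally show ?thesis by simp
qed

lemma topspace_schwartz_topology: "topspace schwartz_topology = schwartz_space"
  unfolding schwartz_topology_def by (rule topspace_seminorm_topology) simp

lemma schwartz_seminorm_diff:
  assumes "f \<in> schwartz_space" "g \<in> schwartz_space"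
  shows "schwartz_seminorm n (f - g) \<le> schwartz_seminorm n f + schwartz_seminorm n g"
proof (intro schwartz_seminorm_least schwartz_weight_least)
  fix x j assume j: "j \<le> n"
  have "(1 + \<bar>x\<bar>\<^sup>2) ^ n * \<bar>(deriv ^^ j) (f - g) x\<bar>
      \<le> (1 + \<bar>x\<bar>\<^sup>2) ^ n * (\<bar>(deriv ^^ j) f x\<bar> + \<bar>(deriv ^^ j) g x\<bar>)"
    using assms by (intro mult_left_mono) (auto simp: iterated_deriv_diff schwartz_space_def)
  also have "\<dots> \<le> schwartz_weight n f x + schwartz_weight n g x"
    unfolding distrib_left by (intro add_mono schwartz_weight_upper j)
  also have "\<dots> \<le> schwartz_seminorm n f + schwartz_seminorm n g"
    by (intro add_mono schwartz_seminorm_upper assms)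
  finally show "(1 + \<bar>x\<bar>\<^sup>2) ^ n * \<bar>(deriv ^^ j) (f - g) x\<bar> \<le> \<dots>" .
qed

lemma schwartz_seminorm_uminus:
  assumes "f \<in> schwartz_space"
  shows "schwartz_seminorm n (- f) = schwartz_seminorm n f"
  using assms
  by (simp add: schwartz_seminorm_def schwartz_weight_def schwartz_space_def iterated_deriv_uminus)

text \<open>On \<open>K\<close> the weight is at most (1 + R^2)^n, and off \<open>K\<close> the
  derivatives vanish; smallness of derivatives thus passes to the seminorms.\<close>

lemma schwartz_weight_test_function_le:
  assumes f: "f \<in> test_functions_on K" and K: "\<And>x. x \<in> K \<Longrightarrow> \<bar>x\<bar> \<le> R" "R \<ge> 0"
    and B: "\<And>j x. j \<le> n \<Longrightarrow> \<bar>(deriv ^^ j) f x\<bar> \<le> B"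
  shows "schwartz_weight n f x \<le> (1 + R\<^sup>2) ^ n * B"
proof (rule schwartz_weight_least)
  fix j assume j: "j \<le> n"
  have "B \<ge> 0" using B[OF j, of 0] by linarith
  show "(1 + \<bar>x\<bar>\<^sup>2) ^ n * \<bar>(deriv ^^ j) f x\<bar> \<le> (1 + R\<^sup>2) ^ n * B"
  proof (cases "x \<in> K")
    case True
    have "(1 + \<bar>x\<bar>\<^sup>2) ^ n \<le> (1 + R\<^sup>2) ^ n"
      using K(1)[OF True] by (intro power_mono add_left_mono) auto
    then show ?thesis
      by (intro mult_mono B j) auto
  next
    case False
    then show ?thesis
      using iterated_deriv_eq_0_outside_support[of f K x j] f \<open>B \<ge> 0\<close>
      by (simp add: test_functions_on_def)
  qed
qed

lemma test_functions_on_subset_schwartz_space: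
  assumes "compact K"
  shows "test_functions_on K \<subseteq> schwartz_space"
proof
  fix f assume f: "f \<in> test_functions_on K"
  obtain R where R: "R > 0" "\<And>x. x \<in> K \<Longrightarrow> \<bar>x\<bar> \<le> R"
    using compact_imp_bounded[OF assms] unfolding bounded_pos by auto
  have "bdd_above (range (schwartz_weight n f))" for n
  proof -
    obtain B where "\<And>j x. j \<le> n \<Longrightarrow> \<bar>(deriv ^^ j) f x\<bar> \<le> B"
      using iterated_deriv_bounded[OF f assms] by blast
    then show ?thesis
      using schwartz_weight_test_function_le[OF f R(2), of n B] R(1) by (intro bdd_aboveI2) auto
  qed
  then show "f \<in> schwartz_space"
    using f by (simp add: schwartz_space_def test_functions_on_def)
qed

lemma schwartz_nhds_0:
  assumes V: "openin schwartz_topology V" "0 \<in> V" and K: "compact K"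
  shows "\<exists>m \<epsilon>. \<epsilon> > 0 \<and> (\<forall>f\<in>test_functions_on K. (\<forall>j\<le>m. \<forall>x. \<bar>(deriv ^^ j) f x\<bar> \<le> \<epsilon>) \<longrightarrow> f \<in> V)"
proof -
  have "\<exists>F \<epsilon>. finite F \<and> F \<subseteq> range schwartz_seminorm \<and> \<epsilon> > 0 \<and>
      {f \<in> schwartz_space. \<forall>p\<in>F. p f < \<epsilon>} \<subseteq> V"
    by (rule seminorm_topology_nhds_0[OF V[unfolded schwartz_topology_def]])
      (auto simp: schwartz_seminorm_diff schwartz_seminorm_uminus)
  then obtain F \<epsilon> where F: "finite F" "F \<subseteq> range schwartz_seminorm" and \<epsilon>: "\<epsilon> > 0"
    and FV: "\<And>f. f \<in> schwartz_space \<Longrightarrow> \<forall>p\<in>F. p f < \<epsilon> \<Longrightarrow> f \<in> V"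
    by blast
  obtain I where I: "finite I" "F = schwartz_seminorm ` I"
    using F by (meson finite_subset_image)
  obtain R where R: "R > 0" "\<And>x. x \<in> K \<Longrightarrow> \<bar>x\<bar> \<le> R"
    using compact_imp_bounded[OF K] unfolding bounded_pos by auto
  \<comment> \<open>\<open>Q\<close> dominates the weight factors of all seminorms with index in
    \<open>I\<close>.\<close>
  define m where "m = Max I"
  define Q where "Q = (1 + R\<^sup>2) ^ m"
  have Q: "Q > 0" unfolding Q_def by (intro zero_less_power) (simp add: add_pos_nonneg)
  have "f \<in> V" if f: "f \<in> test_functions_on K" "\<forall>j\<le>m. \<forall>x. \<bar>(deriv ^^ j) f x\<bar> \<le> \<epsilon> / (2 * Q)" for f
  proof (rule FV)
    show "f \<in> schwartz_space"
      using f(1) test_functions_on_subset_schwartz_space[OF K] by blast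
    have "schwartz_seminorm n f < \<epsilon>" if "n \<in> I" for n
    proof -
      have n: "n \<le> m" using that I by (simp add: m_def)
      have "schwartz_seminorm n f \<le> (1 + R\<^sup>2) ^ n * (\<epsilon> / (2 * Q))"
        using f n R by (intro schwartz_seminorm_least schwartz_weight_test_function_le) auto
      also have "\<dots> \<le> Q * (\<epsilon> / (2 * Q))"
        unfolding Q_def using n \<epsilon> by (intro mult_right_mono power_increasing) auto
      also have "\<dots> < \<epsilon>" using Q \<epsilon> by simp
      finally show ?thesis .
    qed
    then show "\<forall>p\<in>F. p f < \<epsilon>" using I by blast
  qed
  then show ?thesis
    using \<epsilon> Q by (intro exI[of _ m] exI[of _ "\<epsilon> / (2 * Q)"]) auto
qed

lemma schwartz_compact_bounded:
  assumes "compactin schwartz_topology C"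
  shows "\<exists>M. \<forall>f\<in>C. \<forall>x\<in>A. \<bar>(deriv ^^ n) f x\<bar> \<le> M"
proof -
  have "0 \<in> schwartz_space"
    using zero_mem_test_functions_on test_functions_on_subset_schwartz_space[OF compact_empty] by blast
  then obtain M where M: "\<And>f. f \<in> C \<Longrightarrow> schwartz_seminorm n f \<le> M"
    using compactin_seminorm_topology_bounded[OF assms[unfolded schwartz_topology_def],
        of "schwartz_seminorm n"] by auto
  have "C \<subseteq> schwartz_space"
    using compactin_subset_topspace[OF assms] topspace_schwartz_topology by simp
  then have "\<bar>(deriv ^^ n) f x\<bar> \<le> M" if "f \<in> C" for f x
    using abs_iterated_deriv_le_schwartz_seminorm[of f n x] M[OF that] that by force
  then show ?thesis by blast
qed

text \<open>Composing a bump centred at the constant value with the symbol would give a nonzero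
  constant, which does not decay.\<close>

lemma schwartz_symbol_not_constant:
  assumes "schwartz_symbol \<phi>"
  shows "\<not> \<phi> constant_on UNIV"
proof
  assume "\<phi> constant_on UNIV"
  then obtain c where c: "\<And>x. \<phi> x = c" unfolding constant_on_def by auto
  define f where "f = (\<lambda>y. 1 * bump (1 * y + (- c)))"
  have "closure {y. f y \<noteq> 0} \<subseteq> {c-1..c+1}"
  proof (rule closure_minimal)
    show "{y. f y \<noteq> 0} \<subseteq> {c-1..c+1}"
      using bump_eq_0 unfolding f_def by (smt (verit) atLeastAtMost_iff mem_Collect_eq subsetI mult_1)
  qed simp
  then have "f \<in> test_functions_on {c-1..c+1}"
    unfolding test_functions_on_def f_def using smooth_affine[OF smooth_bump] by blast
  then have "f \<in> schwartz_space"
    using test_functions_on_subset_schwartz_space by blast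
  then have *: "f \<circ> \<phi> \<in> schwartz_space"
    using assms by (simp add: schwartz_symbol_def)
  have val: "(f \<circ> \<phi>) x = bump 0" for x by (simp add: f_def c)
  let ?s = "schwartz_seminorm 1 (f \<circ> \<phi>)"
  have bound: "(1 + x\<^sup>2) * bump 0 \<le> ?s" for x
    using schwartz_weight_upper[of 0 1 x "f \<circ> \<phi>"] schwartz_seminorm_upper[OF *, of 1 x] bump_0_pos
    by (simp add: val del: comp_apply)
  have "0 \<le> ?s" using bound[of 0] bump_0_pos by simp
  \<comment> \<open>At this point x^2 bump(0) equals \<open>?s\<close>, so the weighted bound reads
    bump(0) + ?s \<le> ?s.\<close>
  then have "(sqrt (?s / bump 0))\<^sup>2 = ?s / bump 0"
    using bump_0_pos by simp
  then have "(1 + ?s / bump 0) * bump 0 \<le> ?s"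
    using bound[of "sqrt (?s / bump 0)"] by simp
  then show False
    using bump_0_pos by (simp add: distrib_right)
qed

section \<open>Non-compactness on intermediate spaces and on the Schwartz space\<close>

theorem theorem3p3:
  shows "(\<forall>(X :: (real \<Rightarrow> real) topology) \<phi>.
            locally_convex_space X \<and>
            continuously_included test_function_topology X \<and>
            continuously_included X Cinf_topology \<and>
            smooth \<phi> \<and> \<not> \<phi> constant_on UNIV \<and>
            (\<forall>f \<in> topspace X. f \<circ> \<phi> \<in> topspace X)
            \<longrightarrow> \<not> compact_operator X X (\<lambda>f. f \<circ> \<phi>)) \<and>
         (\<forall>\<phi>. schwartz_symbol \<phi> \<longrightarrow>
            \<not> compact_operator schwartz_topology schwartz_topology (\<lambda>f. f \<circ> \<phi>))"
proof (intro conjI allI impI, elim conjE)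
  fix X :: "(real \<Rightarrow> real) topology" and \<phi>
  assume DX: "continuously_included test_function_topology X"
    and XC: "continuously_included X Cinf_topology"
    and \<phi>: "smooth \<phi>" "\<not> \<phi> constant_on UNIV"
    and comp: "\<forall>f \<in> topspace X. f \<circ> \<phi> \<in> topspace X"
  note XC = XC[unfolded continuously_included_def]
  show "\<not> compact_operator X X (\<lambda>f. f \<circ> \<phi>)"
  proof (rule composition_not_compact)
    show "topspace X \<subseteq> {f. smooth f}"
      using continuous_map_image_subset_topspace[OF XC] topspace_Cinf_topology by simp
    show "\<exists>M. \<forall>f\<in>C. \<forall>x\<in>{a..b}. \<bar>(deriv ^^ n) f x\<bar> \<le> M" if "compactin X C" for C n a b
      \<comment> \<open>The continuous inclusion carries compact sets of \<open>X\<close> to compact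
        sets of smooth functions.\<close>
      using image_compactin[OF that XC] by (intro Cinf_compact_bounded) simp
  qed (use intermediate_space_nhds_0[OF DX] \<phi> comp in auto)
next
  fix \<phi> assume \<phi>: "schwartz_symbol \<phi>"
  show "\<not> compact_operator schwartz_topology schwartz_topology (\<lambda>f. f \<circ> \<phi>)"
  proof (rule composition_not_compact)
    show "topspace schwartz_topology \<subseteq> {f. smooth f}"
      by (auto simp: topspace_schwartz_topology schwartz_space_def)
    show "f \<circ> \<phi> \<in> topspace schwartz_topology" if "f \<in> topspace schwartz_topology" for f
      using that \<phi> by (simp add: topspace_schwartz_topology schwartz_symbol_def)
  qed (use schwartz_nhds_0 schwartz_compact_bounded schwartz_symbol_not_constant[OF \<phi>] \<phi> in
      \<open>auto simp: schwartz_symbol_def\<close>)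
qed

end
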